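(* Let $\alpha,\beta,\gamma,\delta,w\in\mathbb{C}$ with $\gamma\notin\{0,-1,-2,\ldots\}$, and let $k\in(0,1)$. For integers $0\le m\le n$ define $f_{m,n}:=k^{2n}$ if $m=0$, and, if $m\geq1$, $$f_{m,n}:=(-1)^{m}k^{2n-2m}\sum_{0\leq\ell_{1}\leq j_{1}<\ell_{2}\leq j_{2}<\cdots<\ell_{m}\leq j_{m}<n}\ \prod_{s=1}^{m}\frac{j_{s}!\,(\gamma)_{j_{s}}(\alpha)_{\ell_{s}}(\beta)_{\ell_{s}}}{\ell_{s}!\,(\gamma)_{\ell_{s}}(\alpha)_{j_{s}+1}(\beta)_{j_{s}+1}}\,k^{-2(j_{s}-\ell_{s})}\big(w-(1-k^{2})\delta\,\ell_{s}\big),$$ where the sum runs over all integers $j_1,\dots,j_m,\ell_1,\dots,\ell_m$ satisfying the indicated inequalities. For $n\ge 0$ put $$c_{n}:=\frac{(\alpha)_{n}(\beta)_{n}}{n!\,(\gamma)_{n}}\sum_{m=0}^{n}f_{m,n}.$$ Then the function $$F(z):=\sum_{n=0}^{\infty}c_{n}z^{n},\qquad z\in D_1=\{z\in\mathbb{C}:|z|<1\},$$ is the local Heun solution $$F(z)=\mathrm{H}\ell\Big(\frac{1}{k^{2}},-\frac{w}{k^{2}}+\alpha\beta;\alpha,\beta,\gamma,\delta;z\Big).$$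
   Context: $(x)_n:=x(x+1)\cdots(x+n-1)$ is the Pochhammer symbol, with $(x)_0=1$. Local Heun solution: for $a,q,\alpha,\beta,\gamma,\delta\in\mathbb{C}$ with $|a|>1$ and $\gamma\notin\{0,-1,-2,\ldots\}$, put $\epsilon:=\alpha+\beta+1-\gamma-\delta$. Then $\mathrm{H}\ell(a,q;\alpha,\beta,\gamma,\delta;z)$ denotes the unique function $F$ analytic in the unit disk $D_1$ with $F(0)=1$ that solves Heun's equation $$F''(z)+\left(\frac{\gamma}{z}+\frac{\delta}{z-1}+\frac{\epsilon}{z-a}\right)F'(z)+\frac{\alpha\beta z-q}{z(z-1)(z-a)}F(z)=0.$$ Convention for degenerate parameters: if $\alpha$ or $\beta$ is a non-positive integer, the product $(\alpha)_n(\beta)_n f_{m,n}$ occurring in $c_n$ is understood after cancellation of common factors: for $0\leq\ell_{1}\leq j_{1}<\cdots<\ell_{m}\leq j_{m}<n$ the expression $(x)_{n}\prod_{s=1}^{m}\frac{(x)_{\ell_{s}}}{(x)_{j_{s}+1}}$ is a polynomial in $x$, namely the product of $(x+i)$ over those $i\in\{0,\dots,n-1\}$ not lying in any of the intervals $[\ell_s,j_s]$, and it is evaluated as this polynomial at $x=\alpha$ and $x=\beta$. *)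

theory Defs
  imports "HOL-Complex_Analysis.Complex_Analysis"
begin

definition is_local_heun ::
  "complex \<Rightarrow> complex \<Rightarrow> complex \<Rightarrow> complex \<Rightarrow> complex \<Rightarrow> complex \<Rightarrow> (complex \<Rightarrow> complex) \<Rightarrow> bool" where
  "is_local_heun a q \<alpha> \<beta> \<gamma> \<delta> F \<longleftrightarrow>
     F holomorphic_on ball 0 1 \<and> F 0 = 1 \<and>
     (let \<epsilon> = \<alpha> + \<beta> + 1 - \<gamma> - \<delta> in
      \<forall>z \<in> ball 0 1 - {0}.
        deriv (deriv F) z
        + (\<gamma> / z + \<delta> / (z - 1) + \<epsilon> / (z - a)) * deriv F z
        + (\<alpha> * \<beta> * z - q) / (z * (z - 1) * (z - a)) * F z = 0)"

(* Functions are total, so the solution is unique only as a function on the disk;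
   membership in extensional pins down the irrelevant values outside it.  The
   definition is meaningful for norm a > 1 and \<gamma> not a non-positive integer. *)
definition local_heun ::
  "complex \<Rightarrow> complex \<Rightarrow> complex \<Rightarrow> complex \<Rightarrow> complex \<Rightarrow> complex \<Rightarrow> complex \<Rightarrow> complex" where
  "local_heun a q \<alpha> \<beta> \<gamma> \<delta> =
     (THE F. F \<in> extensional (ball 0 1) \<and> is_local_heun a q \<alpha> \<beta> \<gamma> \<delta> F)"

(* All (l, j) with 0 <= l_1 <= j_1 < l_2 <= j_2 < ... < l_m <= j_m < n, as functions
   on {1..m}; PiE makes each tuple occur exactly once. *)
definition heun_chains :: "nat \<Rightarrow> nat \<Rightarrow> ((nat \<Rightarrow> nat) \<times> (nat \<Rightarrow> nat)) set" where
  "heun_chains m n =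
     {(l, j). l \<in> {1..m} \<rightarrow>\<^sub>E {..<n} \<and> j \<in> {1..m} \<rightarrow>\<^sub>E {..<n} \<and>
              (\<forall>s\<in>{1..m}. l s \<le> j s) \<and> (\<forall>s\<in>{1..<m}. j s < l (Suc s))}"

definition heun_f ::
  "real \<Rightarrow> complex \<Rightarrow> complex \<Rightarrow> complex \<Rightarrow> complex \<Rightarrow> complex \<Rightarrow> nat \<Rightarrow> nat \<Rightarrow> complex" where
  "heun_f k w \<alpha> \<beta> \<gamma> \<delta> m n =
     (if m = 0 then of_real k ^ (2 * n)
      else (-1) ^ m * of_real k ^ (2 * n - 2 * m) *
        (\<Sum>(l, j)\<in>heun_chains m n. \<Prod>s=1..m.
            (fact (j s) * pochhammer \<gamma> (j s) * pochhammer \<alpha> (l s) * pochhammer \<beta> (l s))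
          / (fact (l s) * pochhammer \<gamma> (l s) * pochhammer \<alpha> (j s + 1) * pochhammer \<beta> (j s + 1))
          * of_real k powi (- 2 * (int (j s) - int (l s)))
          * (w - (1 - of_real k ^ 2) * \<delta> * of_nat (l s))))"

(* The polynomial to which (x)_n * \<Prod>s. (x)_{l_s} / (x)_{j_s + 1} reduces after
   cancellation of common factors; see pochhammer_cancelled_eq below. *)
definition pochhammer_cancelled ::
  "complex \<Rightarrow> nat \<Rightarrow> nat \<Rightarrow> (nat \<Rightarrow> nat) \<Rightarrow> (nat \<Rightarrow> nat) \<Rightarrow> complex" where
  "pochhammer_cancelled x n m l j =
     (\<Prod>i \<in> {..<n} - (\<Union>s\<in>{1..m}. {l s..j s}). x + of_nat i)"

(* (\<alpha>)_n (\<beta>)_n f_{m,n} after cancellation of common factors. *)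
definition heun_f_cancelled ::
  "real \<Rightarrow> complex \<Rightarrow> complex \<Rightarrow> complex \<Rightarrow> complex \<Rightarrow> complex \<Rightarrow> nat \<Rightarrow> nat \<Rightarrow> complex" where
  "heun_f_cancelled k w \<alpha> \<beta> \<gamma> \<delta> m n =
     (if m = 0 then pochhammer \<alpha> n * pochhammer \<beta> n * of_real k ^ (2 * n)
      else (-1) ^ m * of_real k ^ (2 * n - 2 * m) *
        (\<Sum>(l, j)\<in>heun_chains m n.
          pochhammer_cancelled \<alpha> n m l j * pochhammer_cancelled \<beta> n m l j *
          (\<Prod>s=1..m.
            (fact (j s) * pochhammer \<gamma> (j s)) / (fact (l s) * pochhammer \<gamma> (l s))
          * of_real k powi (- 2 * (int (j s) - int (l s)))
          * (w - (1 - of_real k ^ 2) * \<delta> * of_nat (l s)))))"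

definition heun_coeff ::
  "real \<Rightarrow> complex \<Rightarrow> complex \<Rightarrow> complex \<Rightarrow> complex \<Rightarrow> complex \<Rightarrow> nat \<Rightarrow> complex" where
  "heun_coeff k w \<alpha> \<beta> \<gamma> \<delta> n =
     (if \<alpha> \<notin> \<int>\<^sub>\<le>\<^sub>0 \<and> \<beta> \<notin> \<int>\<^sub>\<le>\<^sub>0
      then pochhammer \<alpha> n * pochhammer \<beta> n / (fact n * pochhammer \<gamma> n)
             * (\<Sum>m=0..n. heun_f k w \<alpha> \<beta> \<gamma> \<delta> m n)
      else (\<Sum>m=0..n. heun_f_cancelled k w \<alpha> \<beta> \<gamma> \<delta> m n) / (fact n * pochhammer \<gamma> n))"

lemma heun_chains_less:
  assumes c: "(l, j) \<in> heun_chains m n" and s: "1 \<le> s" and "s < t" "t \<le> m"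
  shows "j s < l t"
  using assms(3,4)
proof (induction t)
  case (Suc t)
  have step: "j t < l (Suc t)" if "1 \<le> t"
    using c that Suc.prems by (auto simp: heun_chains_def)
  show ?case
  proof (cases "s = t")
    case True
    then show ?thesis using step s by simp
  next
    case False
    then have "j s < l t" "1 \<le> t" using Suc s by auto
    moreover have "l t \<le> j t" using c \<open>1 \<le> t\<close> Suc.prems by (auto simp: heun_chains_def)
    ultimately show ?thesis using step by linarith
  qed
qed simp

lemma pochhammer_cancelled_eq:
  assumes x: "x \<notin> \<int>\<^sub>\<le>\<^sub>0" and c: "(l, j) \<in> heun_chains m n"
  shows "pochhammer x n * (\<Prod>s=1..m. pochhammer x (l s) / pochhammer x (j s + 1))
           = pochhammer_cancelled x n m l j"
proof -
  let ?g = "\<lambda>i. x + of_nat i"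
  let ?U = "\<Union>s\<in>{1..m}. {l s..j s}"
  have nz: "?g i \<noteq> 0" for i
    using x by (metis plus_of_nat_eq_0_imp)
  have poch: "pochhammer x p = prod ?g {..<p}" for p
    by (simp add: pochhammer_prod atLeast0LessThan)
  have sub: "?U \<subseteq> {..<n}"
    using c by (fastforce simp: heun_chains_def PiE_def Pi_def)
  have quot: "pochhammer x (l s) / pochhammer x (j s + 1) = inverse (prod ?g {l s..j s})"
    if "s \<in> {1..m}" for s
  proof -
    have "l s \<le> j s" using c that by (auto simp: heun_chains_def)
    then have "{..<j s + 1} = {..<l s} \<union> {l s..j s}" by auto
    then have "pochhammer x (j s + 1) = pochhammer x (l s) * prod ?g {l s..j s}"
      unfolding poch by (simp add: prod.union_disjoint ivl_disj_int)
    moreover have "pochhammer x (l s) \<noteq> 0" unfolding poch using nz by simp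
    ultimately show ?thesis by (simp add: field_simps)
  qed
  have disj: "{l s..j s} \<inter> {l t..j t} = {}" if "s \<in> {1..m}" "t \<in> {1..m}" "s \<noteq> t" for s t
    using heun_chains_less[OF c, of s t] heun_chains_less[OF c, of t s] that
    by (cases "s < t") auto
  have "prod ?g ?U = (\<Prod>s=1..m. prod ?g {l s..j s})"
    using disj by (intro prod.UNION_disjoint) auto
  then have "(\<Prod>s=1..m. pochhammer x (l s) / pochhammer x (j s + 1)) = inverse (prod ?g ?U)"
    using quot prod_inversef[of "\<lambda>s. prod ?g {l s..j s}" "{1..m}"] by (simp add: comp_def)
  moreover have "pochhammer x n = prod ?g ({..<n} - ?U) * prod ?g ?U"
    unfolding poch using sub by (simp add: prod.subset_diff)
  moreover have "prod ?g ?U \<noteq> 0" using nz by (simp add: prod_zero_iff)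
  ultimately show ?thesis by (simp add: pochhammer_cancelled_def)
qed

end

theory Submission
  imports Defs "HOL-Real_Asymp.Real_Asymp"
begin

text \<open>
  Put \<open>b = k\<^sup>2\<close> and \<open>v\<^sub>n = w - (1 - b) \<delta> n\<close>. The power series ansatz turns Heun's equation into a
  three-term recurrence, which telescopes to
  \<open>(n + 1) (n + \<gamma>) c\<^sub>n\<^sub>+\<^sub>1 = b (n + \<alpha>) (n + \<beta>) c\<^sub>n - (\<Sum>p\<le>n. v\<^sub>p c\<^sub>p)\<close>.
  Unrolling it produces the sums over chains: a chain ending below \<open>n + 1\<close> either has all its
  \<open>j\<^sub>s\<close> below \<open>n\<close>, which accounts for the first term, or ends in a pair \<open>(p, n)\<close>, and removing
  that pair leaves a chain ending below \<open>p\<close>, which accounts for the sum. After cancellation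
  all this is polynomial in \<open>\<alpha>\<close> and \<open>\<beta>\<close>, so degenerate parameters need no separate treatment.
  Since \<open>b < 1\<close>, the telescoped recurrence also bounds \<open>c\<^sub>n\<close> by \<open>C r\<^sup>n\<close> for every \<open>r > 1\<close>.
\<close>

section \<open>The coefficients\<close>

lemma finite_heun_chains: "finite (heun_chains m n)"
proof (rule finite_subset)
  show "heun_chains m n \<subseteq> ({1..m} \<rightarrow>\<^sub>E {..<n}) \<times> ({1..m} \<rightarrow>\<^sub>E {..<n})"
    by (auto simp: heun_chains_def)
qed (intro finite_cartesian_product finite_PiE; simp)

lemma heun_chains_0: "heun_chains 0 n = {(\<lambda>_. undefined, \<lambda>_. undefined)}"
  by (auto simp: heun_chains_def)

lemma heun_chains_bounds:
  assumes "(l, j) \<in> heun_chains m n" "1 \<le> s" "s \<le> m"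
  shows "l s \<le> j s" "j s < n"
  using assms by (auto simp: heun_chains_def PiE_def Pi_def)

text \<open>The left endpoints increase strictly, so they are \<open>m\<close> distinct numbers
  below \<open>n\<close>.\<close>

lemma heun_chains_length_le:
  assumes c: "(l, j) \<in> heun_chains m n"
  shows "m \<le> n"
proof -
  have lt: "l s < l t" if "s \<in> {1..m}" "t \<in> {1..m}" "s < t" for s t
    using heun_chains_less[OF c, of s t] heun_chains_bounds(1)[OF c, of s] that by auto
  have "inj_on l {1..m}"
    by (rule linorder_inj_onI) (use lt in fastforce)+
  moreover have "l ` {1..m} \<subseteq> {..<n}"
    using c by (auto simp: heun_chains_def PiE_def Pi_def)
  ultimately show ?thesis
    using card_inj_on_le[of l "{1..m}" "{..<n}"] by simp
qed

lemma heun_chains_snoc: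
  assumes c: "(l, j) \<in> heun_chains m p" and p: "p \<le> n"
  shows "(l(Suc m := p), j(Suc m := n)) \<in> heun_chains (Suc m) (Suc n)"
proof -
  have b: "l s \<le> j s" "j s < p" if "1 \<le> s" "s \<le> m" for s
    using heun_chains_bounds[OF c] that by auto
  have lt: "l s < Suc n" "j s < Suc n" if "1 \<le> s" "s \<le> m" for s
    using b[OF that] p by auto
  have und: "l s = undefined" "j s = undefined" if "s \<notin> {1..m}" for s
    using c that by (auto simp: heun_chains_def PiE_def extensional_def)
  have "j s < l (Suc s)" if "1 \<le> s" "s < m" for s
    using c that by (auto simp: heun_chains_def)
  then show ?thesis
    using b lt p und
    by (auto simp: heun_chains_def PiE_def Pi_def extensional_def le_Suc_eq less_Suc_eq)
qed

text \<open>Every earlier pair ends before the last one begins, hence the bound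
  \<open>l (Suc m)\<close>. Resetting the last entries to \<open>undefined\<close> makes both
  functions extensional on \<open>{1..m}\<close> again.\<close>

lemma heun_chains_butlast:
  assumes c: "(l, j) \<in> heun_chains (Suc m) n"
  shows "(l(Suc m := undefined), j(Suc m := undefined)) \<in> heun_chains m (l (Suc m))"
proof -
  have b: "l s \<le> j s" "j s < l (Suc m)" if "1 \<le> s" "s \<le> m" for s
    using heun_chains_bounds[OF c, of s] heun_chains_less[OF c, of s "Suc m"] that by auto
  have "l s < l (Suc m)" if "1 \<le> s" "s \<le> m" for s using b[OF that] by simp
  moreover have "l s = undefined" "j s = undefined" if "s \<notin> {1..Suc m}" for s
    using c that by (auto simp: heun_chains_def PiE_def extensional_def)
  moreover have "j s < l (Suc s)" if "1 \<le> s" "s < m" for s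
    using c that by (auto simp: heun_chains_def)
  ultimately show ?thesis
    using b by (auto simp: heun_chains_def PiE_def Pi_def extensional_def not_le less_Suc_eq_le)
qed

text \<open>The last right endpoint is the largest entry of the chain, so it alone decides whether
  all entries stay below \<open>n\<close>.\<close>

lemma heun_chains_iff_last_neq:
  "(l, j) \<in> heun_chains (Suc m) n \<longleftrightarrow>
     (l, j) \<in> heun_chains (Suc m) (Suc n) \<and> j (Suc m) \<noteq> n"
proof
  assume c: "(l, j) \<in> heun_chains (Suc m) n"
  then show "(l, j) \<in> heun_chains (Suc m) (Suc n) \<and> j (Suc m) \<noteq> n"
    using heun_chains_bounds(2)[OF c, of "Suc m"]
    by (auto simp: heun_chains_def PiE_def Pi_def less_SucI)
next
  assume a: "(l, j) \<in> heun_chains (Suc m) (Suc n) \<and> j (Suc m) \<noteq> n"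
  then have c: "(l, j) \<in> heun_chains (Suc m) (Suc n)" by blast
  have jn: "j s < n" if "1 \<le> s" "s \<le> Suc m" for s
  proof (cases "s = Suc m")
    case True
    then show ?thesis using heun_chains_bounds(2)[OF c, of s] that a by auto
  next
    case False
    then show ?thesis
      using heun_chains_less[OF c, of s "Suc m"] heun_chains_bounds[OF c, of "Suc m"] that by auto
  qed
  have "l s < n" if "1 \<le> s" "s \<le> Suc m" for s
    using jn[OF that] heun_chains_bounds(1)[OF c that] by simp
  with jn c show "(l, j) \<in> heun_chains (Suc m) n"
    by (auto simp: heun_chains_def PiE_def Pi_def)
qed

text \<open>Chains are split by whether their last pair ends at \<open>n\<close>. Those that do
  correspond bijectively to a left endpoint \<open>p\<close> together with a chain of length
  \<open>m\<close> below \<open>p\<close>. This is the combinatorial core of the recurrence.\<close>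

lemma sum_heun_chains_Suc:
  fixes T :: "(nat \<Rightarrow> nat) \<times> (nat \<Rightarrow> nat) \<Rightarrow> 'a::comm_monoid_add"
  shows "sum T (heun_chains (Suc m) (Suc n)) = sum T (heun_chains (Suc m) n) +
    (\<Sum>p\<le>n. \<Sum>(l, j)\<in>heun_chains m p. T (l(Suc m := p), j(Suc m := n)))"
proof -
  let ?C = "heun_chains (Suc m) (Suc n)"
  let ?B = "{c \<in> ?C. snd c (Suc m) = n}"
  have "heun_chains (Suc m) n = {c \<in> ?C. snd c (Suc m) \<noteq> n}"
    using heun_chains_iff_last_neq[of _ _ m n] by auto
  then have "?C = heun_chains (Suc m) n \<union> ?B" "heun_chains (Suc m) n \<inter> ?B = {}"
    by auto
  then have "sum T ?C = sum T (heun_chains (Suc m) n) + sum T ?B"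
    by (metis (no_types, lifting) finite_Un finite_heun_chains sum.union_disjoint)
  also have "sum T ?B = (\<Sum>(p, l, j)\<in>Sigma {..n} (heun_chains m). T (l(Suc m := p), j(Suc m := n)))"
  proof (rule sum.reindex_bij_witness[where
        i = "\<lambda>(p, l, j). (l(Suc m := p), j(Suc m := n))" and
        j = "\<lambda>(l, j). (l (Suc m), l(Suc m := undefined), j(Suc m := undefined))"])
    fix c assume "c \<in> ?B"
    then obtain l j where c: "c = (l, j)" "(l, j) \<in> ?C" "j (Suc m) = n"
      by (cases c) auto
    moreover have "l (Suc m) \<le> n"
      using heun_chains_bounds[OF c(2), of "Suc m"] by auto
    ultimately show "(case c of (l, j) \<Rightarrow> (l (Suc m), l(Suc m := undefined), j(Suc m := undefined)))
        \<in> Sigma {..n} (heun_chains m)"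
      using heun_chains_butlast by auto
  next
    fix b assume "b \<in> Sigma {..n} (heun_chains m)"
    then obtain p l j where b: "b = (p, l, j)" "p \<le> n" "(l, j) \<in> heun_chains m p"
      by auto
    \<comment> \<open>Extensionality makes appending a pair and then deleting it give back exactly
      the same functions.\<close>
    then have "l (Suc m) = undefined" "j (Suc m) = undefined"
      by (auto simp: heun_chains_def PiE_def extensional_def)
    then have "l(Suc m := undefined) = l" "j(Suc m := undefined) = j"
      by (metis fun_upd_triv)+
    then show "(case (case b of (p, l, j) \<Rightarrow> (l(Suc m := p), j(Suc m := n))) of (l, j) \<Rightarrow>
        (l (Suc m), l(Suc m := undefined), j(Suc m := undefined))) = b"
      using b by simp
    show "(case b of (p, l, j) \<Rightarrow> (l(Suc m := p), j(Suc m := n))) \<in> ?B"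
      using b heun_chains_snoc by auto
  qed auto
  also have "\<dots> = (\<Sum>p\<le>n. \<Sum>(l, j)\<in>heun_chains m p. T (l(Suc m := p), j(Suc m := n)))"
    by (subst sum.Sigma) (auto simp: finite_heun_chains case_prod_unfold)
  finally show ?thesis .
qed

section \<open>Recurrences for the cancelled terms and the coefficients\<close>

lemma pochhammer_cancelled_0: "pochhammer_cancelled x n 0 l j = pochhammer x n"
  by (simp add: pochhammer_cancelled_def pochhammer_prod atLeast0LessThan)

text \<open>All intervals end below \<open>n\<close>, so the new factor \<open>x + of_nat n\<close>
  is not cancelled.\<close>

lemma pochhammer_cancelled_Suc:
  assumes "(l, j) \<in> heun_chains m n"
  shows "pochhammer_cancelled x (Suc n) m l j = (x + of_nat n) * pochhammer_cancelled x n m l j"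
proof -
  have "n \<notin> (\<Union>s\<in>{1..m}. {l s..j s})"
    using heun_chains_bounds[OF assms] by fastforce
  then have "{..<Suc n} - (\<Union>s\<in>{1..m}. {l s..j s}) = insert n ({..<n} - (\<Union>s\<in>{1..m}. {l s..j s}))"
    by (auto simp: less_Suc_eq)
  then show ?thesis by (simp add: pochhammer_cancelled_def)
qed

text \<open>The appended interval \<open>{p..n}\<close> cancels every factor with index from
  \<open>p\<close> on; what is left depends only on the shorter chain below
  \<open>p\<close>.\<close>

lemma pochhammer_cancelled_snoc:
  assumes "p \<le> n"
  shows "pochhammer_cancelled x (Suc n) (Suc m) (l(Suc m := p)) (j(Suc m := n)) =
    pochhammer_cancelled x p m l j"
proof -
  have "(\<Union>s\<in>{1..Suc m}. {(l(Suc m := p)) s..(j(Suc m := n)) s}) =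
      {p..n} \<union> (\<Union>s\<in>{1..m}. {l s..j s})"
    by (auto simp: atLeastAtMostSuc_conv)
  then have "{..<Suc n} - (\<Union>s\<in>{1..Suc m}. {(l(Suc m := p)) s..(j(Suc m := n)) s}) =
      {..<p} - (\<Union>s\<in>{1..m}. {l s..j s})"
    using assms by (auto simp del: atLeastAtMost_iff) (auto)
  then show ?thesis by (simp only: pochhammer_cancelled_def)
qed

text \<open>There is exactly one empty chain and its product is empty, so the general formula covers
  \<open>m = 0\<close> as well.\<close>

lemma heun_f_cancelled_altdef:
  "heun_f_cancelled k w \<alpha> \<beta> \<gamma> \<delta> m n =
     (-1) ^ m * of_real k ^ (2 * n - 2 * m) *
        (\<Sum>(l, j)\<in>heun_chains m n.
          pochhammer_cancelled \<alpha> n m l j * pochhammer_cancelled \<beta> n m l j *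
          (\<Prod>s=1..m.
            (fact (j s) * pochhammer \<gamma> (j s)) / (fact (l s) * pochhammer \<gamma> (l s))
          * of_real k powi (- 2 * (int (j s) - int (l s)))
          * (w - (1 - of_real k ^ 2) * \<delta> * of_nat (l s))))"
  by (simp add: heun_f_cancelled_def heun_chains_0 pochhammer_cancelled_0)

lemma heun_f_cancelled_eq_0:
  assumes "n < m"
  shows "heun_f_cancelled k w \<alpha> \<beta> \<gamma> \<delta> m n = 0"
proof -
  have "heun_chains m n = {}"
    using heun_chains_length_le assms by fastforce
  then show ?thesis by (simp add: heun_f_cancelled_altdef)
qed

lemma heun_f_cancelled_Suc_0:
  "heun_f_cancelled k w \<alpha> \<beta> \<gamma> \<delta> 0 (Suc n) =
    of_real k ^ 2 * (\<alpha> + of_nat n) * (\<beta> + of_nat n) * heun_f_cancelled k w \<alpha> \<beta> \<gamma> \<delta> 0 n"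
  by (simp add: heun_f_cancelled_def pochhammer_Suc power2_eq_square)

text \<open>The two parts of \<open>sum_heun_chains_Suc\<close> give the two terms: a chain that
  stays below \<open>n\<close> gains the uncancelled factors of index \<open>n\<close>, while a
  chain ending in \<open>(p, n)\<close> contributes the weight of that pair times a term of length
  \<open>m\<close> at \<open>p\<close>.\<close>

lemma heun_f_cancelled_Suc_Suc:
  assumes "k \<noteq> 0"
  shows "heun_f_cancelled k w \<alpha> \<beta> \<gamma> \<delta> (Suc m) (Suc n) =
    of_real k ^ 2 * (\<alpha> + of_nat n) * (\<beta> + of_nat n) * heun_f_cancelled k w \<alpha> \<beta> \<gamma> \<delta> (Suc m) n
    - (\<Sum>p\<le>n. (fact n * pochhammer \<gamma> n) / (fact p * pochhammer \<gamma> p) *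
        (w - (1 - of_real k ^ 2) * \<delta> * of_nat p) * heun_f_cancelled k w \<alpha> \<beta> \<gamma> \<delta> m p)"
proof -
  \<comment> \<open>\<open>R p n\<close> is the weight of a single pair \<open>(p, n)\<close>,
    \<open>K\<close> collects the sign and the global power of \<open>k\<close>, and
    \<open>T\<close> is the remaining summand of a chain.\<close>
  define R where "R p n = (fact n * pochhammer \<gamma> n) / (fact p * pochhammer \<gamma> p)
    * complex_of_real k powi (- 2 * (int n - int p)) * (w - (1 - of_real k ^ 2) * \<delta> * of_nat p)" for p n
  define K where "K m n = (-1) ^ m * complex_of_real k ^ (2 * n - 2 * m)" for m n
  define T where "T m n = (\<lambda>(l, j). pochhammer_cancelled \<alpha> n m l j * pochhammer_cancelled \<beta> n m l j *
    (\<Prod>s=1..m. R (l s) (j s)))" for m n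
  have f: "heun_f_cancelled k w \<alpha> \<beta> \<gamma> \<delta> m n = K m n * sum (T m n) (heun_chains m n)" for m n
    by (simp add: heun_f_cancelled_altdef K_def T_def R_def case_prod_unfold)
  have T1: "T (Suc m) (Suc n) c = (\<alpha> + of_nat n) * (\<beta> + of_nat n) * T (Suc m) n c"
    if "c \<in> heun_chains (Suc m) n" for c
    using that by (cases c) (simp add: T_def pochhammer_cancelled_Suc)
  have K1: "K (Suc m) (Suc n) * T (Suc m) (Suc n) c =
      of_real k ^ 2 * (\<alpha> + of_nat n) * (\<beta> + of_nat n) * (K (Suc m) n * T (Suc m) n c)"
    if "c \<in> heun_chains (Suc m) n" for c
  proof -
    \<comment> \<open>The exponent in \<open>K\<close> is a truncated difference. The existence of
      the chain \<open>c\<close> ensures that no truncation occurs, which is why the factor is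
      compared chain by chain.\<close>
    have "Suc m \<le> n" using heun_chains_length_le that by (cases c) auto
    then have "2 * Suc n - 2 * Suc m = 2 + (2 * n - 2 * Suc m)" by simp
    then have "K (Suc m) (Suc n) = of_real k ^ 2 * K (Suc m) n"
      by (simp only: K_def power_add) (simp add: algebra_simps)
    then show ?thesis by (simp add: T1[OF that])
  qed
  have T2: "T (Suc m) (Suc n) (l(Suc m := p), j(Suc m := n)) = R p n * T m p (l, j)"
    if "p \<le> n" for p l j
    using pochhammer_cancelled_snoc[OF that] by (simp add: T_def)
  have K2: "K (Suc m) (Suc n) * (case c of (l, j) \<Rightarrow> T (Suc m) (Suc n) (l(Suc m := p), j(Suc m := n))) =
      - ((fact n * pochhammer \<gamma> n) / (fact p * pochhammer \<gamma> p) *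
        (w - (1 - of_real k ^ 2) * \<delta> * of_nat p) * (K m p * T m p c))"
    if "p \<le> n" "c \<in> heun_chains m p" for p c
  proof -
    have "m \<le> p" using heun_chains_length_le that by (cases c) auto
    then have "2 * Suc n - 2 * Suc m = (2 * p - 2 * m) + 2 * (n - p)" using that by simp
    then have "K (Suc m) (Suc n) = - (K m p * of_real k ^ (2 * (n - p)))"
      by (simp only: K_def power_add) simp
    \<comment> \<open>The surplus power of \<open>k\<close> in \<open>K\<close> cancels the negative
      power in \<open>R p n\<close>; the extra pair accounts for the sign.\<close>
    moreover have "complex_of_real k ^ (2 * (n - p)) * of_real k powi (- 2 * (int n - int p)) = 1"
    proof -
      have "- 2 * (int n - int p) = - int (2 * (n - p))" using that by simp
      then show ?thesis using assms by (simp only: power_int_minus power_int_of_nat) simp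
    qed
    moreover have "- (x * e) * (a * P * v * t) = - (a * v * (x * t))" if "e * P = 1"
      for x e a P v t :: complex
      using that by algebra
    ultimately show ?thesis
      using T2[OF that(1)] by (cases c) (simp only: R_def case_prod_conv)
  qed
  have "heun_f_cancelled k w \<alpha> \<beta> \<gamma> \<delta> (Suc m) (Suc n) =
     (\<Sum>c\<in>heun_chains (Suc m) n. K (Suc m) (Suc n) * T (Suc m) (Suc n) c) +
     (\<Sum>p\<le>n. \<Sum>c\<in>heun_chains m p. K (Suc m) (Suc n) *
        (case c of (l, j) \<Rightarrow> T (Suc m) (Suc n) (l(Suc m := p), j(Suc m := n))))"
    by (simp add: f sum_heun_chains_Suc distrib_left sum_distrib_left)
  also have "\<dots> = of_real k ^ 2 * (\<alpha> + of_nat n) * (\<beta> + of_nat n) * heun_f_cancelled k w \<alpha> \<beta> \<gamma> \<delta> (Suc m) n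
    - (\<Sum>p\<le>n. (fact n * pochhammer \<gamma> n) / (fact p * pochhammer \<gamma> p) *
        (w - (1 - of_real k ^ 2) * \<delta> * of_nat p) * heun_f_cancelled k w \<alpha> \<beta> \<gamma> \<delta> m p)"
    by (simp add: K1 K2 f sum_distrib_left sum_negf)
  finally show ?thesis .
qed

lemma pochhammer_mult_heun_f:
  assumes "\<alpha> \<notin> \<int>\<^sub>\<le>\<^sub>0" "\<beta> \<notin> \<int>\<^sub>\<le>\<^sub>0"
  shows "pochhammer \<alpha> n * pochhammer \<beta> n * heun_f k w \<alpha> \<beta> \<gamma> \<delta> m n =
    heun_f_cancelled k w \<alpha> \<beta> \<gamma> \<delta> m n"
proof (cases "m = 0")
  case False
  have "pochhammer \<alpha> n * pochhammer \<beta> n * (\<Prod>s=1..m.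
            (fact (j s) * pochhammer \<gamma> (j s) * pochhammer \<alpha> (l s) * pochhammer \<beta> (l s))
          / (fact (l s) * pochhammer \<gamma> (l s) * pochhammer \<alpha> (j s + 1) * pochhammer \<beta> (j s + 1))
          * of_real k powi (- 2 * (int (j s) - int (l s)))
          * (w - (1 - of_real k ^ 2) * \<delta> * of_nat (l s))) =
          pochhammer_cancelled \<alpha> n m l j * pochhammer_cancelled \<beta> n m l j *
          (\<Prod>s=1..m.
            (fact (j s) * pochhammer \<gamma> (j s)) / (fact (l s) * pochhammer \<gamma> (l s))
          * of_real k powi (- 2 * (int (j s) - int (l s)))
          * (w - (1 - of_real k ^ 2) * \<delta> * of_nat (l s)))"
    if "(l, j) \<in> heun_chains m n" for l j
    unfolding pochhammer_cancelled_eq[OF assms(1) that, symmetric]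
      pochhammer_cancelled_eq[OF assms(2) that, symmetric]
    by (simp add: prod.distrib prod_dividef mult_ac)
  with False show ?thesis
    by (auto simp: heun_f_def heun_f_cancelled_def sum_distrib_left mult.assoc mult.left_commute
      intro!: sum.cong)
qed (simp add: heun_f_def heun_f_cancelled_def)

text \<open>Both branches of \<open>heun_coeff\<close> reduce to the cancelled form, so later
  arguments need no case distinction on \<alpha> and \<beta>.\<close>

lemma heun_coeff_altdef:
  "heun_coeff k w \<alpha> \<beta> \<gamma> \<delta> n =
    (\<Sum>m\<le>n. heun_f_cancelled k w \<alpha> \<beta> \<gamma> \<delta> m n) / (fact n * pochhammer \<gamma> n)"
proof -
  have "(\<Sum>m\<le>n. heun_f_cancelled k w \<alpha> \<beta> \<gamma> \<delta> m n) =
      pochhammer \<alpha> n * pochhammer \<beta> n * (\<Sum>m\<le>n. heun_f k w \<alpha> \<beta> \<gamma> \<delta> m n)"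
    if "\<alpha> \<notin> \<int>\<^sub>\<le>\<^sub>0" "\<beta> \<notin> \<int>\<^sub>\<le>\<^sub>0"
    by (simp add: pochhammer_mult_heun_f[OF that] sum_distrib_left)
  then show ?thesis
    by (auto simp: heun_coeff_def atLeast0AtMost)
qed

lemma heun_coeff_0: "heun_coeff k w \<alpha> \<beta> \<gamma> \<delta> 0 = 1"
  by (simp add: heun_coeff_altdef heun_f_cancelled_def)

text \<open>Sum the recurrences for \<open>heun_f_cancelled\<close> over \<open>m\<close>. The
  quotient \<open>g n / g p\<close> produced by the last pair is what turns the inner sums at
  \<open>p\<close> into coefficients.\<close>

lemma heun_coeff_Suc:
  assumes "\<gamma> \<notin> \<int>\<^sub>\<le>\<^sub>0" "k \<noteq> 0"
  shows "of_nat (Suc n) * (of_nat n + \<gamma>) * heun_coeff k w \<alpha> \<beta> \<gamma> \<delta> (Suc n) =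
    of_real k ^ 2 * (of_nat n + \<alpha>) * (of_nat n + \<beta>) * heun_coeff k w \<alpha> \<beta> \<gamma> \<delta> n -
    (\<Sum>p\<le>n. (w - (1 - of_real k ^ 2) * \<delta> * of_nat p) * heun_coeff k w \<alpha> \<beta> \<gamma> \<delta> p)"
proof -
  let ?f = "heun_f_cancelled k w \<alpha> \<beta> \<gamma> \<delta>" and ?c = "heun_coeff k w \<alpha> \<beta> \<gamma> \<delta>"
  let ?A = "of_real k ^ 2 * (\<alpha> + of_nat n) * (\<beta> + of_nat n)"
  let ?v = "\<lambda>p. w - (1 - of_real k ^ 2) * \<delta> * of_nat p"
  define g where "g n = fact n * pochhammer \<gamma> n" for n
  have g0: "g n \<noteq> 0" for n
    using assms(1) by (auto simp: g_def pochhammer_eq_0_iff)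
  have c: "?c n = (\<Sum>m\<le>n. ?f m n) / g n" for n
    by (simp add: heun_coeff_altdef g_def)
  \<comment> \<open>Terms with \<open>m > p\<close> vanish, so sums at different \<open>p\<close>
    may share one upper limit.\<close>
  have S: "(\<Sum>m\<le>N. ?f m p) = g p * ?c p" if "p \<le> N" for p N
  proof -
    have "(\<Sum>m\<le>N. ?f m p) = (\<Sum>m\<le>p. ?f m p)"
      by (rule sum.mono_neutral_right) (use that in \<open>auto simp: heun_f_cancelled_eq_0\<close>)
    then show ?thesis using g0 by (simp add: c)
  qed
  have "g (Suc n) * ?c (Suc n) = ?f 0 (Suc n) + (\<Sum>m\<le>n. ?f (Suc m) (Suc n))"
    by (simp only: S[OF order_refl, symmetric] sum.atMost_Suc_shift)
  also have "\<dots> = ?A * ?f 0 n + (\<Sum>m\<le>n. ?A * ?f (Suc m) n - (\<Sum>p\<le>n. g n / g p * ?v p * ?f m p))"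
    by (simp only: heun_f_cancelled_Suc_0 heun_f_cancelled_Suc_Suc[OF assms(2)] g_def)
  also have "\<dots> = ?A * (\<Sum>m\<le>Suc n. ?f m n) - (\<Sum>m\<le>n. \<Sum>p\<le>n. g n / g p * ?v p * ?f m p)"
    by (simp only: sum.atMost_Suc_shift sum_subtractf sum_distrib_left distrib_left add_diff_eq)
  also have "(\<Sum>m\<le>n. \<Sum>p\<le>n. g n / g p * ?v p * ?f m p) =
      (\<Sum>p\<le>n. g n / g p * ?v p * (\<Sum>m\<le>n. ?f m p))"
    by (subst sum.swap) (simp only: sum_distrib_left)
  also have "\<dots> = (\<Sum>p\<le>n. g n * (?v p * ?c p))"
    using g0 by (intro sum.cong refl) (simp add: S)
  also have "(\<Sum>m\<le>Suc n. ?f m n) = g n * ?c n"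
    by (simp only: S[of n "Suc n"] le_SucI order_refl)
  finally have "g (Suc n) * ?c (Suc n) = ?A * (g n * ?c n) - g n * (\<Sum>p\<le>n. ?v p * ?c p)"
    by (simp only: sum_distrib_left)
  moreover have "g (Suc n) = g n * (of_nat (Suc n) * (of_nat n + \<gamma>))"
    by (simp add: g_def pochhammer_Suc mult_ac add.commute)
  ultimately have "g n * (of_nat (Suc n) * (of_nat n + \<gamma>) * ?c (Suc n)) =
      g n * (of_real k ^ 2 * (of_nat n + \<alpha>) * (of_nat n + \<beta>) * ?c n - (\<Sum>p\<le>n. ?v p * ?c p))"
    by (simp add: algebra_simps)
  then show ?thesis
    using g0[of n] by simp
qed

section \<open>Growth of the coefficients and convergence in the disk\<close>

text \<open>Strong induction along \<open>heun_coeff_Suc\<close>: after division by the leading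
  factor, the first term contributes asymptotically \<open>k^2 < r\<close>, and the sum contributes
  only O(1/n), being geometric with weights of order n over a denominator of order n^2.\<close>

lemma heun_coeff_growth:
  assumes "\<gamma> \<notin> \<int>\<^sub>\<le>\<^sub>0" "0 < k" "k < 1" "1 < r"
  obtains C where "\<And>n. norm (heun_coeff k w \<alpha> \<beta> \<gamma> \<delta> n) \<le> C * r ^ n"
proof -
  let ?c = "heun_coeff k w \<alpha> \<beta> \<gamma> \<delta>"
  define V where "V = norm w + norm ((1 - of_real k ^ 2) * \<delta>)"
  have v: "norm (w - (1 - of_real k ^ 2) * \<delta> * of_nat p) \<le> V * real (Suc n)" if "p \<le> n" for p n
  proof -
    have "norm (w - (1 - of_real k ^ 2) * \<delta> * of_nat p) \<le>
        norm w + norm ((1 - of_real k ^ 2) * \<delta>) * real p"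
      by (metis norm_mult norm_of_nat norm_triangle_ineq4)
    also have "\<dots> \<le> norm w * real (Suc n) + norm ((1 - of_real k ^ 2) * \<delta>) * real (Suc n)"
      using that by (intro add_mono mult_left_mono) (auto simp: mult_le_cancel_left1)
    finally show ?thesis by (simp add: V_def algebra_simps)
  qed
  \<comment> \<open>Under the induction hypothesis \<open>B n * (C * r ^ n)\<close> bounds the
    right-hand side of the recurrence; \<open>r / (r - 1)\<close> comes from the geometric sum of
    the powers of \<open>r\<close>.\<close>
  define B where "B n = k ^ 2 * (norm (of_nat n + \<alpha>) * norm (of_nat n + \<beta>)) +
    V * real (Suc n) * (r / (r - 1))" for n
  \<comment> \<open>The complex norms are replaced by real bounds, leaving limits of real rational
    functions.\<close>
  have lim: "((\<lambda>n. k ^ 2 * ((real n + norm \<alpha>) * (real n + norm \<beta>) / (real (Suc n) * (real n - norm \<gamma>))) +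
      V * (r / (r - 1)) / (real n - norm \<gamma>)) \<longlongrightarrow> k ^ 2 * 1 + 0) sequentially"
    by (intro tendsto_add tendsto_mult tendsto_const; real_asymp)
  have "k ^ 2 < r" using assms power_le_one[of k 2] by linarith
  then have "\<forall>\<^sub>F n in sequentially. k ^ 2 * ((real n + norm \<alpha>) * (real n + norm \<beta>) / (real (Suc n) * (real n - norm \<gamma>))) +
      V * (r / (r - 1)) / (real n - norm \<gamma>) < r"
    using order_tendstoD(2)[OF lim] by simp
  moreover have "\<forall>\<^sub>F n in sequentially. real n > norm \<gamma>"
    by real_asymp
  ultimately have "\<forall>\<^sub>F n in sequentially. B n \<le> r * (real (Suc n) * norm (of_nat n + \<gamma>))"
  proof eventually_elim
    case (elim n)
    have "B n \<le> k ^ 2 * ((real n + norm \<alpha>) * (real n + norm \<beta>)) + V * real (Suc n) * (r / (r - 1))"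
      unfolding B_def
      by (intro add_mono mult_left_mono mult_mono order_refl norm_triangle_le) auto
    also have "\<dots> = (k ^ 2 * ((real n + norm \<alpha>) * (real n + norm \<beta>) / (real (Suc n) * (real n - norm \<gamma>))) +
        V * (r / (r - 1)) / (real n - norm \<gamma>)) * (real (Suc n) * (real n - norm \<gamma>))"
      using elim(2) by (simp add: distrib_right del: of_nat_Suc)
    also have "\<dots> \<le> r * (real (Suc n) * (real n - norm \<gamma>))"
      using elim by (intro mult_right_mono) auto
    also have "\<dots> \<le> r * (real (Suc n) * norm (of_nat n + \<gamma>))"
      using assms norm_diff_ineq[of "of_nat n" \<gamma>] by (intro mult_left_mono) auto
    finally show ?case .
  qed
  then obtain N where N: "B n \<le> r * (real (Suc n) * norm (of_nat n + \<gamma>))" if "n \<ge> N" for n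
    by (auto simp: eventually_sequentially)
  \<comment> \<open>Since \<open>r ^ n\<close> is at least 1, this \<open>C\<close> covers all
    indices up to \<open>N\<close>; beyond \<open>N\<close> the estimate on \<open>B\<close> drives
    the induction.\<close>
  define C where "C = (\<Sum>n\<le>N. norm (?c n))"
  have "norm (?c n) \<le> C * r ^ n" for n
  proof (induction n rule: less_induct)
    case (less n)
    have C0: "0 \<le> C" by (simp add: C_def sum_nonneg)
    show ?case
    proof (cases "n \<le> N")
      case True
      then have "norm (?c n) \<le> C"
        unfolding C_def by (intro member_le_sum) auto
      also have "\<dots> \<le> C * r ^ n"
        using C0 assms by (simp add: mult_le_cancel_left1)
      finally show ?thesis .
    next
      case False
      then obtain m where m: "n = Suc m" "N \<le> m" by (cases n) auto
      have IH: "norm (?c p) \<le> C * r ^ p" if "p \<le> m" for p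
        using less.IH that m by simp
      define d where "d = real (Suc m) * norm (of_nat m + \<gamma>)"
      have "of_nat m + \<gamma> \<noteq> 0"
        using assms(1) by (metis add.commute plus_of_nat_eq_0_imp)
      then have d: "d > 0" by (simp add: d_def)
      have "d * norm (?c n) = norm (of_nat (Suc m) * (of_nat m + \<gamma>) * ?c (Suc m))"
        by (simp add: norm_mult d_def m del: of_nat_Suc)
      also have "\<dots> = norm (of_real k ^ 2 * (of_nat m + \<alpha>) * (of_nat m + \<beta>) * ?c m -
          (\<Sum>p\<le>m. (w - (1 - of_real k ^ 2) * \<delta> * of_nat p) * ?c p))"
        using assms by (subst heun_coeff_Suc) auto
      also have "\<dots> \<le> k ^ 2 * (norm (of_nat m + \<alpha>) * norm (of_nat m + \<beta>)) * norm (?c m) +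
          (\<Sum>p\<le>m. norm (w - (1 - of_real k ^ 2) * \<delta> * of_nat p) * norm (?c p))"
        by (rule order_trans[OF norm_triangle_ineq4 add_mono])
          (auto simp: norm_mult norm_power mult.assoc intro!: sum_norm_le)
      also have "\<dots> \<le> k ^ 2 * (norm (of_nat m + \<alpha>) * norm (of_nat m + \<beta>)) * (C * r ^ m) +
          (\<Sum>p\<le>m. V * real (Suc m) * (C * r ^ p))"
        using IH v by (intro add_mono mult_left_mono sum_mono mult_mono) (auto simp: V_def)
      also have "(\<Sum>p\<le>m. V * real (Suc m) * (C * r ^ p)) =
          V * real (Suc m) * C * ((r ^ Suc m - 1) / (r - 1))"
        using assms geometric_sum[of r "Suc m"]
        by (simp add: sum_distrib_left[symmetric] mult.assoc[symmetric] lessThan_Suc_atMost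
          del: sum.lessThan_Suc sum.atMost_Suc of_nat_Suc power_Suc)
      also have "\<dots> \<le> V * real (Suc m) * C * (r ^ Suc m / (r - 1))"
        using assms C0 by (intro mult_left_mono divide_right_mono) (auto simp: V_def)
      also have "k ^ 2 * (norm (of_nat m + \<alpha>) * norm (of_nat m + \<beta>)) * (C * r ^ m) +
          V * real (Suc m) * C * (r ^ Suc m / (r - 1)) = B m * (C * r ^ m)"
        by (simp add: B_def algebra_simps)
      also have "\<dots> \<le> r * d * (C * r ^ m)"
        using N[OF m(2)] C0 assms unfolding d_def by (intro mult_right_mono) auto
      finally have "d * norm (?c n) \<le> d * (C * r ^ n)"
        by (simp add: m algebra_simps)
      with d show ?thesis by simp
    qed
  qed
  then show ?thesis by (rule that)
qed

lemma summable_heun_coeff: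
  assumes "\<gamma> \<notin> \<int>\<^sub>\<le>\<^sub>0" "0 < k" "k < 1" "norm z < 1"
  shows "summable (\<lambda>n. heun_coeff k w \<alpha> \<beta> \<gamma> \<delta> n * z ^ n)"
proof -
  \<comment> \<open>Chosen so that \<open>1 < r\<close> and \<open>r * norm z < 1\<close>, including
    at \<open>z = 0\<close>.\<close>
  define r where "r = 2 / (1 + norm z)"
  have z: "0 < 1 + norm z" using norm_ge_zero[of z] by linarith
  have r: "1 < r" "r * norm z < 1"
    using assms(4) z by (auto simp: r_def field_simps)
  obtain C where C: "\<And>n. norm (heun_coeff k w \<alpha> \<beta> \<gamma> \<delta> n) \<le> C * r ^ n"
    using heun_coeff_growth[OF assms(1-3) r(1)] by blast
  show ?thesis
  proof (rule summable_comparison_test')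
    show "summable (\<lambda>n. C * (r * norm z) ^ n)"
      using r by (intro summable_mult summable_geometric) (auto simp: abs_mult)
    show "norm (heun_coeff k w \<alpha> \<beta> \<gamma> \<delta> n * z ^ n) \<le> C * (r * norm z) ^ n" for n
      using mult_right_mono[OF C[of n], of "norm z ^ n"]
      by (simp add: norm_mult norm_power power_mult_distrib mult.assoc)
  qed
qed

section \<open>The differential equation\<close>

text \<open>
  The left-hand side of Heun's equation with \<open>a = 1 / b\<close> and \<open>q = \<alpha> \<beta> - w / b\<close>, multiplied
  by \<open>z (z - 1) (b z - 1)\<close>.
\<close>
definition heun_fps :: "complex \<Rightarrow> complex \<Rightarrow> complex \<Rightarrow> complex \<Rightarrow> complex \<Rightarrow> complex \<Rightarrow> complex fps \<Rightarrow> complex fps" where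
  "heun_fps b w \<alpha> \<beta> \<gamma> \<delta> f =
     fps_of_poly [:0, 1, - (1 + b), b:] * fps_deriv (fps_deriv f) +
     fps_of_poly [:\<gamma>, - (\<gamma> + (1 - b) * \<delta> + b * (\<alpha> + \<beta> + 1)), b * (\<alpha> + \<beta> + 1):] * fps_deriv f +
     fps_of_poly [:w - b * \<alpha> * \<beta>, b * \<alpha> * \<beta>:] * f"

text \<open>With \<open>D n = (n+1) (n+\<gamma>) f $ (n+1) - b (n+\<alpha>) (n+\<beta>) f $
  n\<close>, the coefficient of index \<open>n+1\<close> is \<open>D (n+1) - D n\<close> plus the
  summand of index \<open>n+1\<close>, so the partial sums telescope.\<close>

lemma sum_heun_fps_nth:
  "(\<Sum>p\<le>n. heun_fps b w \<alpha> \<beta> \<gamma> \<delta> f $ p) =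
    of_nat (Suc n) * (of_nat n + \<gamma>) * f $ Suc n - b * (of_nat n + \<alpha>) * (of_nat n + \<beta>) * f $ n +
    (\<Sum>p\<le>n. (w - (1 - b) * \<delta> * of_nat p) * f $ p)"
proof (induction n)
  case 0
  show ?case
    by (simp add: heun_fps_def fps_of_poly_pCons algebra_simps)
next
  case (Suc n)
  have "heun_fps b w \<alpha> \<beta> \<gamma> \<delta> f $ Suc n =
      of_nat (Suc (Suc n)) * (of_nat (Suc n) + \<gamma>) * f $ Suc (Suc n)
      - b * (of_nat (Suc n) + \<alpha>) * (of_nat (Suc n) + \<beta>) * f $ Suc n
      + (w - (1 - b) * \<delta> * of_nat (Suc n)) * f $ Suc n
      - of_nat (Suc n) * (of_nat n + \<gamma>) * f $ Suc n + b * (of_nat n + \<alpha>) * (of_nat n + \<beta>) * f $ n"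
    by (cases n) (simp_all add: heun_fps_def fps_of_poly_pCons algebra_simps)
  with Suc.IH show ?case by simp
qed

text \<open>All coefficients vanish exactly when all their partial sums do.\<close>

lemma heun_fps_eq_0_iff:
  "heun_fps b w \<alpha> \<beta> \<gamma> \<delta> f = 0 \<longleftrightarrow>
    (\<forall>n. of_nat (Suc n) * (of_nat n + \<gamma>) * f $ Suc n =
      b * (of_nat n + \<alpha>) * (of_nat n + \<beta>) * f $ n - (\<Sum>p\<le>n. (w - (1 - b) * \<delta> * of_nat p) * f $ p))"
proof -
  let ?h = "fps_nth (heun_fps b w \<alpha> \<beta> \<gamma> \<delta> f)"
  have "(\<forall>n. ?h n = 0) \<longleftrightarrow> (\<forall>n. (\<Sum>p\<le>n. ?h p) = 0)"
  proof (intro iffI allI)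
    fix n assume *: "\<forall>n. (\<Sum>p\<le>n. ?h p) = 0"
    show "?h n = 0"
    proof (cases n)
      case 0
      then show ?thesis using spec[OF *, of 0] by simp
    next
      case (Suc m)
      then show ?thesis using spec[OF *, of m] spec[OF *, of n] by simp
    qed
  qed simp
  then show ?thesis
    unfolding sum_heun_fps_nth fps_eq_iff by (simp add: algebra_simps)
qed

text \<open>As \<open>n + \<gamma>\<close> is never zero, the telescoped recurrence determines each
  coefficient from the earlier ones, and \<open>heun_coeff\<close> satisfies it.\<close>

lemma heun_coeff_fps_unique:
  assumes "\<gamma> \<notin> \<int>\<^sub>\<le>\<^sub>0" "k \<noteq> 0"
  shows "f $ 0 = 1 \<and> heun_fps (of_real k ^ 2) w \<alpha> \<beta> \<gamma> \<delta> f = 0 \<longleftrightarrow>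
    f = Abs_fps (heun_coeff k w \<alpha> \<beta> \<gamma> \<delta>)"
proof
  assume f: "f $ 0 = 1 \<and> heun_fps (of_real k ^ 2) w \<alpha> \<beta> \<gamma> \<delta> f = 0"
  have "f $ n = heun_coeff k w \<alpha> \<beta> \<gamma> \<delta> n" for n
  proof (induction n rule: less_induct)
    case (less n)
    show ?case
    proof (cases n)
      case 0
      then show ?thesis using f by (simp add: heun_coeff_0)
    next
      case (Suc m)
      have "of_nat m + \<gamma> \<noteq> 0"
        using assms(1) by (metis add.commute plus_of_nat_eq_0_imp)
      then have "of_nat (Suc m) * (of_nat m + \<gamma>) \<noteq> 0"
        by (simp del: of_nat_Suc)
      moreover have "of_nat (Suc m) * (of_nat m + \<gamma>) * f $ Suc m =
          of_nat (Suc m) * (of_nat m + \<gamma>) * heun_coeff k w \<alpha> \<beta> \<gamma> \<delta> (Suc m)"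
        using f less.IH Suc
        by (simp add: heun_fps_eq_0_iff heun_coeff_Suc[OF assms] del: of_nat_Suc)
      ultimately show ?thesis using Suc by (metis mult_left_cancel)
    qed
  qed
  then show "f = Abs_fps (heun_coeff k w \<alpha> \<beta> \<gamma> \<delta>)" by (simp add: fps_eq_iff)
next
  assume "f = Abs_fps (heun_coeff k w \<alpha> \<beta> \<gamma> \<delta>)"
  then show "f $ 0 = 1 \<and> heun_fps (of_real k ^ 2) w \<alpha> \<beta> \<gamma> \<delta> f = 0"
    by (simp add: heun_fps_eq_0_iff heun_coeff_Suc[OF assms] heun_coeff_0 del: of_nat_Suc)
qed

section \<open>From formal power series to functions on the disk\<close>

text \<open>Derivatives at points of an open set depend only on values there. This allows passing
  between total functions, their restrictions and their Taylor series.\<close>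

lemma is_local_heun_cong:
  assumes "\<And>z. z \<in> ball 0 1 \<Longrightarrow> F z = G z" "is_local_heun a q \<alpha> \<beta> \<gamma> \<delta> F"
  shows "is_local_heun a q \<alpha> \<beta> \<gamma> \<delta> G"
proof -
  have holF: "F holomorphic_on ball 0 1"
    using assms(2) by (simp add: is_local_heun_def)
  then have holG: "G holomorphic_on ball 0 1"
    by (rule holomorphic_transform) (rule assms(1))
  have d: "deriv F z = deriv G z" if "z \<in> ball 0 1" for z
    by (rule complex_derivative_transform_within_open[OF holF holG open_ball that assms(1)])
  have dd: "deriv (deriv F) z = deriv (deriv G) z" if "z \<in> ball 0 1" for z
    by (rule complex_derivative_transform_within_open[OF _ _ open_ball that d])
      (auto intro!: holomorphic_deriv holF holG)
  show ?thesis
    using assms(2) holG assms(1) d dd by (simp add: is_local_heun_def)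
qed

text \<open>On the punctured disk the left-hand side of the equation is the value of
  \<open>heun_fps\<close> divided by a polynomial without zeros there, and a power series vanishing
  near 0 is zero.\<close>

lemma is_local_heun_eval_fps_iff:
  assumes "b \<noteq> 0" "norm b < 1" "1 \<le> fps_conv_radius f"
  shows "is_local_heun (1 / b) (- w / b + \<alpha> * \<beta>) \<alpha> \<beta> \<gamma> \<delta> (eval_fps f) \<longleftrightarrow>
    f $ 0 = 1 \<and> heun_fps b w \<alpha> \<beta> \<gamma> \<delta> f = 0"
proof -
  let ?H = "heun_fps b w \<alpha> \<beta> \<gamma> \<delta> f"
  have rad: "1 \<le> fps_conv_radius (fps_deriv f)" "1 \<le> fps_conv_radius (fps_deriv (fps_deriv f))"
    using assms(3) fps_conv_radius_deriv[of f] fps_conv_radius_deriv[of "fps_deriv f"]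
    by (auto intro: order_trans)
  have in_disk: "ereal (norm z) < fps_conv_radius g" if "z \<in> ball 0 1" "1 \<le> fps_conv_radius g" for z :: complex and g
    using that by (auto intro: less_le_trans[of _ 1] simp: one_ereal_def)
  have hol: "eval_fps g holomorphic_on ball 0 1" if "1 \<le> fps_conv_radius g" for g :: "complex fps"
    using that in_disk by (intro holomorphic_on_eval_fps) auto
  have d: "deriv (eval_fps f) z = eval_fps (fps_deriv f) z" if "z \<in> ball 0 1" for z
    by (rule eval_fps_deriv[symmetric]) (rule in_disk[OF that assms(3)])
  have dd: "deriv (deriv (eval_fps f)) z = eval_fps (fps_deriv (fps_deriv f)) z" if z: "z \<in> ball 0 1" for z
  proof -
    have "deriv (deriv (eval_fps f)) z = deriv (eval_fps (fps_deriv f)) z"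
      by (rule complex_derivative_transform_within_open[OF _ _ open_ball z d])
        (auto intro!: holomorphic_deriv hol rad assms(3))
    also have "\<dots> = eval_fps (fps_deriv (fps_deriv f)) z"
      by (rule eval_fps_deriv[symmetric]) (rule in_disk[OF z rad(1)])
    finally show ?thesis .
  qed
  have radH: "1 \<le> fps_conv_radius ?H"
    unfolding heun_fps_def
    by (intro order_trans[OF _ fps_conv_radius_add] order_trans[OF _ fps_conv_radius_mult] min.boundedI)
      (auto intro: rad assms(3))
  have evH: "eval_fps ?H z = z * (z - 1) * (b * z - 1) * eval_fps (fps_deriv (fps_deriv f)) z +
      (\<gamma> * ((z - 1) * (b * z - 1)) + \<delta> * (z * (b * z - 1)) +
        (\<alpha> + \<beta> + 1 - \<gamma> - \<delta>) * b * (z * (z - 1))) * eval_fps (fps_deriv f) z +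
      (b * \<alpha> * \<beta> * z + w - b * \<alpha> * \<beta>) * eval_fps f z" if z: "z \<in> ball 0 1" for z
  proof -
    have [simp]: "ereal (norm z) < fps_conv_radius (fps_of_poly p * g)"
      if "1 \<le> fps_conv_radius g" for p g
      by (rule in_disk[OF z], rule order_trans[OF _ fps_conv_radius_mult]) (use that in auto)
    have [simp]: "ereal (norm z) < fps_conv_radius (g + h)"
      if "ereal (norm z) < fps_conv_radius g" "ereal (norm z) < fps_conv_radius h" for g h :: "complex fps"
      using that by (intro less_le_trans[OF _ fps_conv_radius_add]) (auto simp: min_def)
    have "eval_fps (fps_of_poly p * g) z = poly p z * eval_fps g z"
      if "1 \<le> fps_conv_radius g" for p g
      using in_disk[OF z that] by (simp add: eval_fps_mult)
    then show ?thesis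
      unfolding heun_fps_def
      using rad assms(3) by (simp add: eval_fps_add) (simp add: algebra_simps)
  qed
  have ode: "deriv (deriv (eval_fps f)) z
        + (\<gamma> / z + \<delta> / (z - 1) + (\<alpha> + \<beta> + 1 - \<gamma> - \<delta>) / (z - 1 / b)) * deriv (eval_fps f) z
        + (\<alpha> * \<beta> * z - (- w / b + \<alpha> * \<beta>)) / (z * (z - 1) * (z - 1 / b)) * eval_fps f z
      = eval_fps ?H z / (z * (z - 1) * (b * z - 1))"
    and nz: "z * (z - 1) * (b * z - 1) \<noteq> 0"
    if z: "z \<in> ball 0 1 - {0}" for z
  proof -
    have "norm (b * z) < 1"
      using z assms(2) mult_strict_mono'[of "norm b" 1 "norm z" 1] by (auto simp: norm_mult)
    then have z': "z \<noteq> 0" "z - 1 \<noteq> 0" "b * z - 1 \<noteq> 0"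
      using z by auto
    then show "z * (z - 1) * (b * z - 1) \<noteq> 0" by simp
    have za: "z - 1 / b = (b * z - 1) / b"
      using assms(1) by (simp add: field_simps)
    have zd: "z \<in> ball 0 1" using z by blast
    have qb: "\<alpha> * \<beta> * z - (- w / b + \<alpha> * \<beta>) = (b * \<alpha> * \<beta> * z + w - b * \<alpha> * \<beta>) / b"
      using assms(1) by (simp add: field_simps)
    \<comment> \<open>The identity to be proved holds with \<open>z\<close>, \<open>x\<close>,
      \<open>y\<close> as independent nonzero quantities, so clearing denominators suffices.\<close>
    define x where "x = z - 1"
    define y where "y = b * z - 1"
    have "x \<noteq> 0" "y \<noteq> 0" using z' by (auto simp: x_def y_def)
    then show "deriv (deriv (eval_fps f)) z
        + (\<gamma> / z + \<delta> / (z - 1) + (\<alpha> + \<beta> + 1 - \<gamma> - \<delta>) / (z - 1 / b)) * deriv (eval_fps f) z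
        + (\<alpha> * \<beta> * z - (- w / b + \<alpha> * \<beta>)) / (z * (z - 1) * (z - 1 / b)) * eval_fps f z
      = eval_fps ?H z / (z * (z - 1) * (b * z - 1))"
      unfolding evH[OF zd] d[OF zd] dd[OF zd] za qb x_def[symmetric] y_def[symmetric]
      using z'(1) assms(1) by (simp add: divide_simps) (simp add: algebra_simps)
  qed
  have "is_local_heun (1 / b) (- w / b + \<alpha> * \<beta>) \<alpha> \<beta> \<gamma> \<delta> (eval_fps f) \<longleftrightarrow>
      f $ 0 = 1 \<and> (\<forall>z\<in>ball 0 1 - {0}. eval_fps ?H z = 0)"
    unfolding is_local_heun_def Let_def using hol[OF assms(3)]
    by (simp only: ode nz divide_eq_0_iff eval_fps_at_0 simp_thms cong: ball_cong)
  also have "(\<forall>z\<in>ball 0 1 - {0}. eval_fps ?H z = 0) \<longleftrightarrow> ?H = 0"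
  proof
    assume H: "\<forall>z\<in>ball 0 1 - {0}. eval_fps ?H z = 0"
    \<comment> \<open>Nothing is known yet at the origin. Multiplication by \<open>fps_X\<close>
      forces the value 0 there and loses no information, since \<open>fps_X\<close> is not a zero
      divisor.\<close>
    have radX: "1 \<le> fps_conv_radius (fps_X * ?H)"
      using radH by (intro order_trans[OF _ fps_conv_radius_mult]) auto
    have "eval_fps (fps_X * ?H) z = eval_fps 0 z" if "z \<in> ball 0 1" for z
      using that H in_disk[OF that radH] by (cases "z = 0") (auto simp: eval_fps_mult)
    then have "\<forall>\<^sub>F z in nhds 0. eval_fps (fps_X * ?H) z = eval_fps 0 z"
      using eventually_nhds_in_open[of "ball 0 1" "0::complex"] by (auto elim: eventually_mono)
    then have "fps_X * ?H = 0"
      using radX by (intro eval_fps_eqD) (auto intro: less_le_trans[of 0 1])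
    then show "?H = 0" by simp
  qed simp
  finally show ?thesis .
qed

theorem theorem3:
  fixes \<alpha> \<beta> \<gamma> \<delta> w :: complex and k :: real
  assumes "\<gamma> \<notin> \<int>\<^sub>\<le>\<^sub>0" and "0 < k" and "k < 1"
  shows "(\<forall>z\<in>ball 0 1. summable (\<lambda>n. heun_coeff k w \<alpha> \<beta> \<gamma> \<delta> n * z ^ n)) \<and>
         is_local_heun (1 / of_real k ^ 2) (- w / of_real k ^ 2 + \<alpha> * \<beta>) \<alpha> \<beta> \<gamma> \<delta>
           (\<lambda>z. \<Sum>n. heun_coeff k w \<alpha> \<beta> \<gamma> \<delta> n * z ^ n) \<and>
         (\<forall>z\<in>ball 0 1. (\<Sum>n. heun_coeff k w \<alpha> \<beta> \<gamma> \<delta> n * z ^ n) =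
           local_heun (1 / of_real k ^ 2) (- w / of_real k ^ 2 + \<alpha> * \<beta>) \<alpha> \<beta> \<gamma> \<delta> z)"
proof -
  let ?c = "heun_coeff k w \<alpha> \<beta> \<gamma> \<delta>"
  let ?S = "is_local_heun (1 / of_real k ^ 2) (- w / of_real k ^ 2 + \<alpha> * \<beta>) \<alpha> \<beta> \<gamma> \<delta>"
  define F where "F = eval_fps (Abs_fps ?c)"
  have F: "F = (\<lambda>z. \<Sum>n. ?c n * z ^ n)"
    by (simp add: F_def eval_fps_def fun_eq_iff)
  have sm: "summable (\<lambda>n. ?c n * z ^ n)" if "norm z < 1" for z
    by (rule summable_heun_coeff[OF assms that])
  have rad: "1 \<le> fps_conv_radius (Abs_fps ?c)"
    unfolding fps_conv_radius_def fps_nth_Abs_fps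
    by (rule conv_radius_geI_ex') (auto intro!: sm simp: one_ereal_def)
  have k: "k \<noteq> 0" "complex_of_real k ^ 2 \<noteq> 0" "norm (complex_of_real k ^ 2) < 1"
    using assms by (auto simp: norm_power power_less_one_iff abs_square_less_1)
  note iff = is_local_heun_eval_fps_iff[OF k(2,3)] heun_coeff_fps_unique[OF assms(1) k(1)]
  have SF: "?S F"
    unfolding F_def using rad by (simp only: iff)
  \<comment> \<open>A solution is holomorphic on the disk, hence equal to its Taylor series there,
    and that series solves the formal equation with constant term 1.\<close>
  have unique: "G z = F z" if G: "?S G" and z: "z \<in> ball 0 1" for G z
  proof -
    define g where "g = fps_expansion G 0"
    have holG: "G holomorphic_on eball 0 1"
      using G by (simp add: is_local_heun_def one_ereal_def)
    have radg: "1 \<le> fps_conv_radius g"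
      unfolding g_def by (rule conv_radius_fps_expansion[OF holG])
    have ev: "eval_fps g z = G z" if "z \<in> ball 0 1" for z
      unfolding g_def using eval_fps_expansion'[OF holG, of z] that by (simp add: one_ereal_def)
    have "?S (eval_fps g)"
      using is_local_heun_cong[OF _ G, of "eval_fps g"] ev by simp
    then have "g = Abs_fps ?c"
      using radg by (simp only: iff)
    then show ?thesis using ev[OF z] by (simp add: F_def)
  qed
  \<comment> \<open>The description ranges over extensional functions, so its witness is
    \<open>F\<close> restricted to the disk.\<close>
  have "local_heun (1 / of_real k ^ 2) (- w / of_real k ^ 2 + \<alpha> * \<beta>) \<alpha> \<beta> \<gamma> \<delta> = restrict F (ball 0 1)"
    unfolding local_heun_def
  proof (rule the_equality)
    show "restrict F (ball 0 1) \<in> extensional (ball 0 1) \<and> ?S (restrict F (ball 0 1))"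
      using is_local_heun_cong[OF _ SF, of "restrict F (ball 0 1)"] by simp
  next
    fix G assume G: "G \<in> extensional (ball 0 1) \<and> ?S G"
    show "G = restrict F (ball 0 1)"
      by (rule extensionalityI[of _ "ball 0 1"]) (use G unique in auto)
  qed
  then show ?thesis
    using sm SF unfolding F by simp
qed

end
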